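(* Let $G$ be a graph. Then $$\chi(G)\le (\dim(G)+1)\cdot \bigl|\log_2(|G|)\bigr|,$$ where $\chi(G)$ is the chromatic number of $G$ (the minimum number of colors needed to color the vertices so that no two adjacent vertices have the same color), $\dim(G)$ is the dimension of $G$ defined in the context, $|G|$ is the number of vertices of $G$, and the outer bars denote absolute value.
   Context: All graphs are finite, simple and undirected; $|G|$ denotes the number of vertices of a graph $G$. For a graph $H$, let $\delta(H)=\max_{x\in V(H)}\deg_H(x)$ denote its maximum degree. For a graph $G'$ define its sub-dimension $$\mathrm{subdim}(G')=\min_{G''}\ \delta(G''),$$ where the minimum is over all induced subgraphs $G''=(V'',E'')$ of $G'$ (i.e. $E''$ consists of all edges of $G'$ with both endpoints in $V''$) with $|V''|\ge \lfloor |G'|/2\rfloor+1$. The dimension of a graph $G$ is $$\dim(G)=\max_{G'}\ \mathrm{subdim}(G'),$$ where the maximum is over all induced subgraphs $G'$ of $G$ (on a nonempty vertex set).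
   Formalization: The formal theorem assumes that G has at least two vertices; for one vertex the stated inequality fails (it would read 1 ≤ 0), and for the empty graph the dimension and the logarithm are undefined. *)

theory Defs
  imports Complex_Main "Graph_Theory.Graph_Theory"
begin

text \<open>
  Finite simple undirected graphs are the loop-free symmetric digraphs without parallel arcs of
  the locale \<^locale>\<open>graph\<close>: an edge \<open>{u, v}\<close> is the pair of arcs \<open>(u, v)\<close>, \<open>(v, u)\<close>.
  Hence the degree of a vertex is its out-degree; see \<open>out_degree_eq_card_neighbours\<close>.
\<close>

definition max_degree :: "('a, 'b) pre_digraph \<Rightarrow> nat" where
  "max_degree H = Max (out_degree H ` verts H)"

definition subdim :: "('a, 'b) pre_digraph \<Rightarrow> nat" where
  "subdim G' = Min {max_degree G'' | G''.
     induced_subgraph G'' G' \<and> card (verts G'') \<ge> card (verts G') div 2 + 1}"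

definition graph_dim :: "('a, 'b) pre_digraph \<Rightarrow> nat" where
  "graph_dim G = Max {subdim G' | G'. induced_subgraph G' G \<and> verts G' \<noteq> {}}"

definition proper_colouring :: "('a, 'b) pre_digraph \<Rightarrow> ('a \<Rightarrow> nat) \<Rightarrow> bool" where
  "proper_colouring G c \<longleftrightarrow> (\<forall>u \<in> verts G. \<forall>v \<in> verts G. u \<rightarrow>\<^bsub>G\<^esub> v \<longrightarrow> c u \<noteq> c v)"

definition chromatic_number :: "('a, 'b) pre_digraph \<Rightarrow> nat" where
  "chromatic_number G = (LEAST k. \<exists>c. proper_colouring G c \<and> c ` verts G \<subseteq> {..<k})"


text \<open>
  The extrema above range over finite nonempty sets, and some number of colours always suffices,
  so none of these definitions falls back on an unspecified value (except on the null graph).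
\<close>

lemma out_degree_eq_card_neighbours:
  assumes "graph G"
  shows "out_degree G v = card {w \<in> verts G. v \<rightarrow>\<^bsub>G\<^esub> w}"
proof -
  interpret graph G by fact
  have "bij_betw (head G) (out_arcs G v) {w \<in> verts G. v \<rightarrow>\<^bsub>G\<^esub> w}"
    unfolding bij_betw_def
  proof
    show "inj_on (head G) (out_arcs G v)"
      by (auto simp: inj_on_def out_arcs_def arc_to_ends_def intro!: no_multi_arcs)
    show "head G ` out_arcs G v = {w \<in> verts G. v \<rightarrow>\<^bsub>G\<^esub> w}"
      by (auto simp: out_arcs_def arcs_ends_def arc_to_ends_def)
  qed
  then show ?thesis
    unfolding out_degree_def by (rule bij_betw_same_card)
qed

lemma finite_induced_subgraphs:
  assumes "graph G"
  shows "finite {H. induced_subgraph H G}"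
proof (rule finite_subset)
  interpret graph G by fact
  show "finite (induce_subgraph G ` Pow (verts G))" by simp
  show "{H. induced_subgraph H G} \<subseteq> induce_subgraph G ` Pow (verts G)"
  proof
    fix H assume "H \<in> {H. induced_subgraph H G}"
    then have "H = G \<restriction> verts H" "verts H \<subseteq> verts G"
      by (auto simp: induced_subgraph_def subgraph_def compatible_def induce_subgraph_def
               intro!: pre_digraph.equality)
    then show "H \<in> induce_subgraph G ` Pow (verts G)" by blast
  qed
qed

lemma subdim_candidates:
  assumes "graph G" "verts G \<noteq> {}"
  defines "S \<equiv> {max_degree H | H. induced_subgraph H G \<and> card (verts H) \<ge> card (verts G) div 2 + 1}"
  shows "finite S" and "S \<noteq> {}"
proof -
  interpret graph G by fact
  have "S \<subseteq> max_degree ` {H. induced_subgraph H G}"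
    unfolding S_def by auto
  then show "finite S"
    using finite_induced_subgraphs[OF assms(1)] finite_subset by blast
  have "card (verts G) > 0" using assms(2) by (simp add: card_gt_0_iff)
  then show "S \<noteq> {}"
    unfolding S_def using induced_subgraph_refl by auto
qed

lemma graph_dim_candidates:
  assumes "graph G" "verts G \<noteq> {}"
  defines "S \<equiv> {subdim H | H. induced_subgraph H G \<and> verts H \<noteq> {}}"
  shows "finite S" and "S \<noteq> {}"
proof -
  interpret graph G by fact
  have "S \<subseteq> subdim ` {H. induced_subgraph H G}"
    unfolding S_def by auto
  then show "finite S"
    using finite_induced_subgraphs[OF assms(1)] finite_subset by blast
  show "S \<noteq> {}"
    unfolding S_def using induced_subgraph_refl assms(2) by auto
qed

lemma proper_colouring_exists:
  assumes "graph G"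
  shows "\<exists>c. proper_colouring G c \<and> c ` verts G \<subseteq> {..<card (verts G)}"
proof -
  interpret graph G by fact
  obtain c where c: "bij_betw c (verts G) {0..<card (verts G)}"
    using ex_bij_betw_finite_nat[OF finite_verts] by blast
  have "proper_colouring G c"
    unfolding proper_colouring_def
    using c no_loops by (auto simp: bij_betw_def inj_on_def arcs_ends_def arc_to_ends_def)
  moreover have "c ` verts G \<subseteq> {..<card (verts G)}"
    using c by (auto simp: bij_betw_def)
  ultimately show ?thesis by blast
qed

end

theory Submission
  imports Defs
begin

text \<open>
  Let \<open>n = |G|\<close> and \<open>d = dim G\<close>. Every nonempty set of vertices contains more than half of itself
  as a set inducing maximum degree at most \<open>d\<close>, which is greedily coloured with \<open>d + 1\<close> colours.
  Peeling off \<open>k\<close> such sets, where \<open>2^k \<le> n < 2^(k+1)\<close>, exhausts the vertices, except that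
  one vertex can be left over when \<open>n = 2^(k+1) - 1\<close>. Its extra colour is affordable:
  if \<open>d \<ge> 1\<close>, then \<open>log 2 n \<ge> k + 1/2\<close> gives room for it, and if \<open>d = 0\<close>, there are no edges.
\<close>

section \<open>Colourings of vertex sets under an adjacency relation\<close>

text \<open>A bare relation and a set, instead of a graph, let the peeling argument pass to subsets
  without forming induced subgraphs.\<close>

definition colourable_on :: "('a \<Rightarrow> 'a \<Rightarrow> bool) \<Rightarrow> 'a set \<Rightarrow> nat \<Rightarrow> bool" where
  "colourable_on E S k \<longleftrightarrow>
     (\<exists>c. c ` S \<subseteq> {..<k} \<and> (\<forall>u \<in> S. \<forall>v \<in> S. E u v \<longrightarrow> c u \<noteq> c v))"

lemma colourable_on_card_le:
  assumes "finite S" "card S \<le> m" "irreflp E"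
  shows "colourable_on E S m"
proof -
  obtain c where c: "bij_betw c S {0..<card S}"
    using ex_bij_betw_finite_nat[OF assms(1)] by blast
  have "c ` S \<subseteq> {..<m}"
    using c assms(2) by (auto simp: bij_betw_def)
  moreover have "c u \<noteq> c v" if "u \<in> S" "v \<in> S" "E u v" for u v
    using that c irreflpD[OF assms(3)] by (metis bij_betw_def inj_onD)
  ultimately show ?thesis
    unfolding colourable_on_def by blast
qed

lemma colourable_on_Un:
  assumes "colourable_on E A k" "colourable_on E B l"
  shows "colourable_on E (A \<union> B) (k + l)"
proof -
  obtain a where a: "a ` A \<subseteq> {..<k}" "\<forall>u \<in> A. \<forall>v \<in> A. E u v \<longrightarrow> a u \<noteq> a v"
    using assms(1) unfolding colourable_on_def by blast
  obtain b where b: "b ` B \<subseteq> {..<l}" "\<forall>u \<in> B. \<forall>v \<in> B. E u v \<longrightarrow> b u \<noteq> b v"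
    using assms(2) unfolding colourable_on_def by blast
  \<comment> \<open>Shifting by \<open>k\<close> separates the two palettes; a vertex in both sets
    keeps its colour from \<open>a\<close>.\<close>
  define c where "c = (\<lambda>v. if v \<in> A then a v else k + b v)"
  have "c ` (A \<union> B) \<subseteq> {..<k + l}"
    using a(1) b(1) by (auto simp: c_def image_subset_iff trans_less_add1)
  moreover have "c u \<noteq> c v" if "u \<in> A \<union> B" "v \<in> A \<union> B" "E u v" for u v
  proof (cases "u \<in> A \<longleftrightarrow> v \<in> A")
    case True
    then show ?thesis
      using that a(2) b(2) by (auto simp: c_def)
  next
    case False
    have "a x < k" if "x \<in> A" for x
      using a(1) that by blast
    then show ?thesis
      using False by (metis c_def not_add_less1)
  qed
  ultimately show ?thesis
    unfolding colourable_on_def by blast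
qed

text \<open>Greedy colouring: a newly inserted vertex has at most \<open>d\<close> coloured
  neighbours, so one of \<open>d + 1\<close> colours is free for it.\<close>

lemma colourable_on_degree_bound:
  assumes "finite T" "symp E" "irreflp E" "\<forall>v \<in> T. card {w \<in> T. E v w} \<le> d"
  shows "colourable_on E T (d + 1)"
  using assms(1,4)
proof (induction T rule: finite_induct)
  case empty
  then show ?case by (simp add: colourable_on_def)
next
  case (insert x T)
  have "card {w \<in> T. E v w} \<le> d" if "v \<in> T" for v
  proof -
    have "card {w \<in> T. E v w} \<le> card {w \<in> insert x T. E v w}"
      using insert.hyps by (intro card_mono) auto
    then show ?thesis
      using insert.prems that by fastforce
  qed
  then obtain c where c: "c ` T \<subseteq> {..<d + 1}" "\<forall>u \<in> T. \<forall>v \<in> T. E u v \<longrightarrow> c u \<noteq> c v"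
    using insert.IH unfolding colourable_on_def by blast
  let ?N = "{w \<in> T. E x w}"
  have "?N = {w \<in> insert x T. E x w}"
    using irreflpD[OF assms(3)] by blast
  then have "card ?N \<le> d"
    using insert.prems by simp
  then have "card (c ` ?N) < card {..<d + 1}"
    using card_image_le[of ?N c] insert.hyps by simp
  then have "\<not> {..<d + 1} \<subseteq> c ` ?N"
    using insert.hyps card_mono[of "c ` ?N" "{..<d + 1}"] by auto
  then obtain j where j: "j < d + 1" "j \<notin> c ` ?N"
    by auto
  let ?c = "c(x := j)"
  have "?c ` insert x T \<subseteq> {..<d + 1}"
    using c(1) j(1) by auto
  moreover have "?c u \<noteq> ?c v" if "u \<in> insert x T" "v \<in> insert x T" "E u v" for u v
  proof -
    \<comment> \<open>\<open>?N\<close> records only arcs leaving \<open>x\<close>; symmetry covers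
      a conflict along an arc into \<open>x\<close>.\<close>
    have "u \<noteq> v" "E v u"
      using that(3) irreflpD[OF assms(3)] sympD[OF assms(2)] by blast+
    then show ?thesis
      using that c(2) j(2) by auto
  qed
  ultimately show ?case
    unfolding colourable_on_def by blast
qed

text \<open>The bound on \<open>card S\<close> is what \<open>k\<close> rounds of \<open>n \<mapsto> \<lceil>n/2\<rceil> - 1\<close> reduce to at most \<open>m\<close>.\<close>

lemma colourable_on_halving:
  fixes V :: "'a set"
  assumes "finite V" "symp E" "irreflp E"
    and half: "\<And>S. S \<subseteq> V \<Longrightarrow> S \<noteq> {} \<Longrightarrow>
      \<exists>T \<subseteq> S. card S div 2 + 1 \<le> card T \<and> (\<forall>v \<in> T. card {w \<in> T. E v w} \<le> d)"
    and "S \<subseteq> V" "card S + 1 < 2 ^ k * (m + 2)"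
  shows "colourable_on E S (k * (d + 1) + m)"
  using assms(5,6)
proof (induction k arbitrary: S)
  case 0
  then have "finite S"
    using assms(1) finite_subset by blast
  with 0 show ?case
    by (auto intro!: colourable_on_card_le assms(3))
next
  case (Suc k)
  show ?case
  proof (cases "S = {}")
    case True
    then show ?thesis by (simp add: colourable_on_def)
  next
    case False
    then obtain T where T: "T \<subseteq> S" "card S div 2 + 1 \<le> card T"
      "\<forall>v \<in> T. card {w \<in> T. E v w} \<le> d"
      using half Suc.prems(1) by blast
    have fin: "finite S" "finite T"
      using assms(1) Suc.prems(1) T(1) by (blast intro: finite_subset)+
    have "card (S - T) = card S - card T"
      using T(1) fin by (simp add: card_Diff_subset)
    moreover have "card S + 1 < 2 * (2 ^ k * (m + 2))"
      using Suc.prems(2) by simp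
    \<comment> \<open>Removing more than half of \<open>S\<close> at least halves
      \<open>card S + 1\<close>, which is why the bound is stated for the cardinality plus
      one.\<close>
    ultimately have "card (S - T) + 1 < 2 ^ k * (m + 2)"
      using T(2) card_mono[OF fin(1) T(1)] by linarith
    then have "colourable_on E (S - T) (k * (d + 1) + m)"
      using Suc.IH Suc.prems(1) by blast
    moreover have "colourable_on E T (d + 1)"
      using colourable_on_degree_bound fin(2) assms(2,3) T(3) by blast
    moreover have "T \<union> (S - T) = S"
      using T(1) by blast
    ultimately show ?thesis
      using colourable_on_Un[of E T "d + 1" "S - T" "k * (d + 1) + m"]
      by (simp add: algebra_simps)
  qed
qed

section \<open>Induced subgraphs and the dimension\<close>

lemma dominates_induced_subgraph_iff:
  assumes "induced_subgraph H G"
  shows "u \<rightarrow>\<^bsub>H\<^esub> v \<longleftrightarrow> u \<in> verts H \<and> v \<in> verts H \<and> u \<rightarrow>\<^bsub>G\<^esub> v"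
proof -
  have "tail H = tail G" "head H = head G"
    using assms by (auto simp: induced_subgraph_def subgraph_def compatible_def)
  moreover have "arcs H = {e \<in> arcs G. tail G e \<in> verts H \<and> head G e \<in> verts H}"
    using assms by (simp add: induced_subgraph_def)
  ultimately show ?thesis
    by (auto simp: arcs_ends_conv)
qed

lemma graph_induced_subgraph:
  assumes "graph G" "induced_subgraph H G"
  shows "graph H"
proof -
  interpret graph G by fact
  have "subgraph H G"
    using assms(2) by (simp add: induced_subgraph_def)
  then have "digraph H"
    by (rule digraph_subgraph)
  moreover have "symmetric H"
    using dominates_induced_subgraph_iff[OF assms(2)] sym_arcs
    by (auto simp: symmetric_def sym_def)
  ultimately show ?thesis
    by (simp add: digraph.graphI)
qed

text \<open>Translates the dimension into the hypothesis \<open>half\<close> of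
  \<open>colourable_on_halving\<close>, by looking at the subgraph induced on
  \<open>S\<close>.\<close>

lemma graph_dim_half:
  assumes "graph G" "S \<subseteq> verts G" "S \<noteq> {}"
  shows "\<exists>T \<subseteq> S. card S div 2 + 1 \<le> card T \<and>
    (\<forall>v \<in> T. card {w \<in> T. v \<rightarrow>\<^bsub>G\<^esub> w} \<le> graph_dim G)"
proof -
  interpret graph G by fact
  define H where "H = G \<restriction> S"
  have H: "induced_subgraph H G" "verts H = S"
    using assms(2) by (auto simp: H_def intro: induced_induce)
  have graph_H: "graph H"
    using graph_induced_subgraph assms(1) H(1) .
  \<comment> \<open>The candidates form a finite nonempty set, so the minimum is attained at some
    \<open>K\<close>; its vertices serve as \<open>T\<close>.\<close>
  have "subdim H \<in> {max_degree K | K. induced_subgraph K H \<and> card (verts K) \<ge> card (verts H) div 2 + 1}"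
    using subdim_candidates[OF graph_H] H(2) assms(3) unfolding subdim_def by (intro Min_in) auto
  then obtain K where K: "induced_subgraph K H" "card S div 2 + 1 \<le> card (verts K)"
    "max_degree K = subdim H"
    using H(2) by auto
  have "subdim H \<in> {subdim G' | G'. induced_subgraph G' G \<and> verts G' \<noteq> {}}"
    using H assms(3) by blast
  then have le: "subdim H \<le> graph_dim G"
    using graph_dim_candidates[OF assms(1)] assms(2,3) unfolding graph_dim_def
    by (intro Max_ge) auto
  have graph_K: "graph K"
    using graph_induced_subgraph graph_H K(1) .
  then interpret K: graph K .
  have sub: "verts K \<subseteq> S"
    using K(1) H(2) by (auto simp: induced_subgraph_def subgraph_def)
  have "card {w \<in> verts K. v \<rightarrow>\<^bsub>G\<^esub> w} \<le> graph_dim G" if "v \<in> verts K" for v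
  proof -
    have "{w \<in> verts K. v \<rightarrow>\<^bsub>G\<^esub> w} = {w \<in> verts K. v \<rightarrow>\<^bsub>K\<^esub> w}"
      using that sub H(2)
      by (auto simp: dominates_induced_subgraph_iff[OF K(1)] dominates_induced_subgraph_iff[OF H(1)])
    then have "card {w \<in> verts K. v \<rightarrow>\<^bsub>G\<^esub> w} = out_degree K v"
      using out_degree_eq_card_neighbours[OF graph_K] by simp
    also have "\<dots> \<le> max_degree K"
      unfolding max_degree_def using that by (intro Max_ge) auto
    finally show ?thesis
      using K(3) le by simp
  qed
  with sub K(2) show ?thesis by blast
qed

text \<open>More than half of a two-element set is all of it, so on \<open>{u, v}\<close> the degree
  bound already has to admit the edge itself.\<close>

lemma graph_dim_pos:
  assumes "graph G" "u \<rightarrow>\<^bsub>G\<^esub> v"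
  shows "graph_dim G \<ge> 1"
proof -
  interpret graph G by fact
  have uv: "{u, v} \<subseteq> verts G" "u \<noteq> v"
    using assms(2) adj_not_same by (auto simp: adj_in_verts)
  obtain T where T: "T \<subseteq> {u, v}" "card {u, v} div 2 + 1 \<le> card T"
    "\<forall>x \<in> T. card {w \<in> T. x \<rightarrow>\<^bsub>G\<^esub> w} \<le> graph_dim G"
    using graph_dim_half[OF assms(1) uv(1)] by blast
  have "T = {u, v}"
    using T(1,2) uv(2) by (intro card_seteq) auto
  moreover from this have "card {v} \<le> card {w \<in> T. u \<rightarrow>\<^bsub>G\<^esub> w}"
    using assms(2) by (intro card_mono) auto
  ultimately show ?thesis
    using T(3) by fastforce
qed

section \<open>The chromatic number and the logarithmic estimate\<close>

lemma chromatic_number_le: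
  assumes "colourable_on (\<lambda>u v. u \<rightarrow>\<^bsub>G\<^esub> v) (verts G) k"
  shows "chromatic_number G \<le> k"
  using assms unfolding chromatic_number_def colourable_on_def proper_colouring_def
  by (intro Least_le) blast

text \<open>With \<open>x = 2 ^ k\<close>, doubling and exponentiating turns the claim into
  \<open>2 * x^2 \<le> (2 * x - 1)^2\<close>. The difference of the sides is
  \<open>2 * (x - 1)^2 - 1\<close>, which is positive for \<open>x \<ge> 2\<close> but negative for
  \<open>x = 1\<close>, that is, for \<open>k = 0\<close>.\<close>

lemma log2_pow2_minus_one_ge:
  assumes "k \<ge> 1"
  shows "real k + 1 / 2 \<le> log 2 (2 ^ (k + 1) - 1)"
proof -
  define x :: real where "x = 2 ^ k"
  have x: "x \<ge> 2"
    using assms power_increasing[of 1 k "2::real"] by (simp add: x_def)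
  have "0 \<le> 2 * (x - 1)\<^sup>2 - 1"
    using x one_le_power[of "x - 1" 2] by linarith
  then have "2 * x\<^sup>2 \<le> (2 * x - 1)\<^sup>2"
    by (simp add: power2_eq_square algebra_simps)
  then have "log 2 (2 * x\<^sup>2) \<le> log 2 ((2 * x - 1)\<^sup>2)"
    using x by (intro log_mono) auto
  moreover have "log 2 (2 * x\<^sup>2) = 1 + 2 * real k"
    by (simp add: x_def log_mult log_nat_power)
  moreover have "log 2 ((2 * x - 1)\<^sup>2) = 2 * log 2 (2 * x - 1)"
    using x by (simp add: log_nat_power)
  ultimately show ?thesis
    by (simp add: x_def)
qed

theorem theorem3p4:
  fixes G :: "('a, 'b) pre_digraph"
  assumes "graph G"
    and "card (verts G) \<ge> 2"
  shows "real (chromatic_number G)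
           \<le> (real (graph_dim G) + 1) * \<bar>log 2 (real (card (verts G)))\<bar>"
proof -
  interpret graph G by fact
  let ?E = "\<lambda>u v. u \<rightarrow>\<^bsub>G\<^esub> v"
  define n where "n = card (verts G)"
  define d where "d = graph_dim G"
  define L where "L = log 2 (real n)"
  have "symp ?E" "irreflp ?E"
    using arcs_ends_symmetric[OF sym_arcs] adj_not_same by (blast intro: sympI irreflpI)+
  then have colourable: "colourable_on ?E (verts G) (k * (d + 1) + m)"
    if "n + 1 < 2 ^ k * (m + 2)" for k m
    using that colourable_on_halving[of "verts G" ?E d "verts G" k m]
      graph_dim_half[OF assms(1)] by (simp add: n_def d_def)
  obtain k where k: "2 ^ k \<le> n" "n < 2 ^ (k + 1)"
    using ex_power_ivl1[of 2 n] assms(2) by (auto simp: n_def)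
  \<comment> \<open>A single vertex would give \<open>k = 0\<close>, and there the bound fails: one
    colour is needed but the logarithm is 0.\<close>
  have "k \<ge> 1"
    using k assms(2) by (cases k) (auto simp: n_def)
  have "real k \<le> L"
    using k(1) assms(2) unfolding L_def n_def
    by (simp add: le_log_iff powr_realpow numeral_power_le_of_nat_cancel_iff)
  have "real (chromatic_number G) \<le> (real d + 1) * L"
  \<comment> \<open>Exhausting all vertices (\<open>m = 0\<close>) takes
    \<open>n + 1 < 2 ^ k * 2\<close>; since \<open>n < 2 ^ (k + 1)\<close>, only equality is
    exceptional.\<close>
  proof (cases "n + 1 = 2 ^ (k + 1)")
    case False
    then have "chromatic_number G \<le> k * (d + 1)"
      using chromatic_number_le colourable[of k 0] k(2) by simp
    then have "real (chromatic_number G) \<le> real (k * (d + 1))"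
      by (rule of_nat_mono)
    also have "\<dots> = (real d + 1) * real k"
      by (simp add: algebra_simps)
    also have "\<dots> \<le> (real d + 1) * L"
      using \<open>real k \<le> L\<close> by (intro mult_left_mono) auto
    finally show ?thesis .
  next
    case n: True
    show ?thesis
    proof (cases "d = 0")
      case True
      \<comment> \<open>An edge would force \<open>d \<ge> 1\<close>, so a constant colouring is
        proper, and \<open>1 \<le> k \<le> L\<close>.\<close>
      then have "colourable_on ?E (verts G) 1"
        using graph_dim_pos[OF assms(1)] by (fastforce simp: colourable_on_def d_def)
      then have "chromatic_number G \<le> 1"
        by (rule chromatic_number_le)
      then show ?thesis
        using \<open>real k \<le> L\<close> \<open>k \<ge> 1\<close> True by simp
    next
      case False
      have "real n = 2 ^ (k + 1) - 1"
        using arg_cong[OF n, of real] by simp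
      then have "real k + 1 / 2 \<le> L"
        using log2_pow2_minus_one_ge[OF \<open>k \<ge> 1\<close>] by (simp add: L_def)
      then have "(real d + 1) * (real k + 1 / 2) \<le> (real d + 1) * L"
        by (intro mult_left_mono) auto
      \<comment> \<open>Here \<open>m = 1\<close> suffices because
        \<open>2 ^ (k + 1) < 2 ^ k * 3\<close>. The additional colour is paid for by the surplus
        \<open>(d + 1) / 2 \<ge> 1\<close> that the extra 1/2 in the logarithm yields.\<close>
      moreover have "chromatic_number G \<le> k * (d + 1) + 1"
        using chromatic_number_le colourable[of k 1] n by simp
      then have "real (chromatic_number G) \<le> real (k * (d + 1) + 1)"
        by (rule of_nat_mono)
      moreover have "real d \<ge> 1"
        using False by simp
      moreover have "(real d + 1) * (real k + 1 / 2) = real (k * (d + 1)) + (real d + 1) / 2"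
        by (simp add: algebra_simps add_divide_distrib)
      ultimately show ?thesis
        unfolding of_nat_add of_nat_1 by argo
    qed
  qed
  also have "\<dots> \<le> (real d + 1) * \<bar>L\<bar>"
    by (intro mult_left_mono) auto
  finally show ?thesis
    by (simp add: L_def n_def d_def)
qed

end
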